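(* Let $\mathbb{F}$ be a field with $|\mathbb{F}|>2$ and $\operatorname{char}\mathbb{F}\neq 2$, let $n\ge 3$, and let $V$ be an $n$-dimensional $\mathbb{F}$-vector space, $G=GL(V)$. Then $\mathcal{N}$ and $\mathcal{M}^{\ast}_{(1,1)}$ are the only nonzero proper $G$-submodules of $\mathcal{C}$. Moreover: (1) if $\operatorname{char}\mathbb{F}\nmid n+1$, then $\mathcal{N}\cap\mathcal{M}^{\ast\ast}=0$ and $\mathcal{C}=\mathcal{N}\oplus\mathcal{M}^{\ast}_{(1,1)}$ is a direct sum of irreducible $G$-modules (in particular $\mathcal{C}$ has precisely two composition series); (2) if $\operatorname{char}\mathbb{F}\mid n+1$, then $\mathcal{C}$ has the unique composition series $0\subset\mathcal{M}^{\ast}_{(1,1)}\subset\mathcal{N}\subset\mathcal{C}$.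
   Context: $V$ is an $n$-dimensional vector space over $\mathbb{F}$ with a fixed basis $v_1,\dots,v_n$; $G=GL(V)$ acts on $V$ on the left; $\widehat V$ is the dual space of $V$. $\boldsymbol{\Lambda}=\mathbb{F}^{n^3}$ is the space of structure vectors $\boldsymbol{\lambda}=(\lambda_{ijk})_{1\le i,j,k\le n}$; such a vector corresponds to the (not necessarily associative) algebra on $V$ whose bilinear product is $[v_i,v_j]=\sum_k\lambda_{ijk}v_k$. $G$ acts linearly on $\boldsymbol{\Lambda}$ on the right: $\boldsymbol{\lambda}g$ is the structure vector of the product $[u,v]'=g^{-1}[gu,gv]$. $G$-submodules of $\boldsymbol{\Lambda}$ are with respect to this action. Define the following $G$-submodules of $\boldsymbol{\Lambda}$ (where $[\,,\,]$ is the product with structure vector $\boldsymbol{\lambda}$): $\mathcal{C}$ = all $\boldsymbol{\lambda}$ with $[u,v]=[v,u]$ for all $u,v\in V$; $\mathcal{T}$ = all $\boldsymbol{\lambda}$ such that for every $u\in V$ the linear map $v\mapsto[u,v]$ has trace $0$; $\mathcal{N}=\mathcal{C}\cap\mathcal{T}$; $\mathcal{M}^{\ast\ast}$ = all $\boldsymbol{\lambda}$ with $[v,v]\in\mathbb{F}v$ for all $v\in V$; $\mathcal{M}^{\ast}_{(1,1)}$ = all structure vectors of products of the form $[u,v]=\theta(v)u+\theta(u)v$ with $\theta\in\widehat V$. Characteristic $0$ is regarded as not dividing any nonzero integer. *)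

theory Defs
  imports "HOL-Analysis.Analysis"
begin

text \<open>
  \<open>V\<close> is the type \<open>'v\<close>, with scalar multiplication \<open>scale\<close> over the field \<open>'f\<close>, and the basis
  \<open>v\<close> is indexed by the finite type \<open>'n\<close>, so that the dimension is \<open>CARD('n)\<close>.
  A structure vector is \<open>\<lambda> :: 'f^'n^'n^'n\<close>, with entries \<open>\<lambda> $ i $ j $ k\<close>.
\<close>

definition lscale :: "'f::field \<Rightarrow> 'f^'n^'n^'n \<Rightarrow> 'f^'n^'n^'n" where
  "lscale c l = (\<chi> i j k. c * l $ i $ j $ k)"

definition direct_sum :: "('f::field^'n^'n^'n) set \<Rightarrow> ('f^'n^'n^'n) set \<Rightarrow> ('f^'n^'n^'n) set \<Rightarrow> bool" where
  "direct_sum W U U' \<longleftrightarrow> W = {a + b | a b. a \<in> U \<and> b \<in> U'} \<and> U \<inter> U' = {0}"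

locale based_vector_space = vector_space scale
  for scale :: "'f::field \<Rightarrow> 'v::ab_group_add \<Rightarrow> 'v" +
  fixes v :: "'n::finite \<Rightarrow> 'v"
  assumes inj_basis: "inj v"
    and independent_basis: "\<not> dependent (range v)"
    and span_basis: "span (range v) = UNIV"
begin

definition coord :: "'v \<Rightarrow> 'n \<Rightarrow> 'f" where
  "coord x i = representation (range v) x (v i)"

definition dual :: "('v \<Rightarrow> 'f) set" where
  "dual = {\<theta>. Vector_Spaces.linear scale (*) \<theta>}"

definition GL :: "('v \<Rightarrow> 'v) set" where
  "GL = {g. Vector_Spaces.linear scale scale g \<and> bij g}"

definition map_trace :: "('v \<Rightarrow> 'v) \<Rightarrow> 'f" where
  "map_trace f = trace (\<chi> i j. coord (f (v j)) i)"

definition alg_prod :: "'f^'n^'n^'n \<Rightarrow> 'v \<Rightarrow> 'v \<Rightarrow> 'v" where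
  "alg_prod l x y =
     (\<Sum>i\<in>UNIV. \<Sum>j\<in>UNIV. \<Sum>k\<in>UNIV. scale (coord x i * coord y j * l $ i $ j $ k) (v k))"

definition structure_vector :: "('v \<Rightarrow> 'v \<Rightarrow> 'v) \<Rightarrow> 'f^'n^'n^'n" where
  "structure_vector b = (\<chi> i j k. coord (b (v i) (v j)) k)"

definition act :: "'f^'n^'n^'n \<Rightarrow> ('v \<Rightarrow> 'v) \<Rightarrow> 'f^'n^'n^'n" where
  "act l g = structure_vector (\<lambda>x y. inv g (alg_prod l (g x) (g y)))"

definition gsubmodule :: "('f^'n^'n^'n) set \<Rightarrow> bool" where
  "gsubmodule W \<longleftrightarrow> module.subspace lscale W \<and> (\<forall>g\<in>GL. \<forall>l\<in>W. act l g \<in> W)"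

definition irreducible_gmodule :: "('f^'n^'n^'n) set \<Rightarrow> bool" where
  "irreducible_gmodule W \<longleftrightarrow>
     gsubmodule W \<and> W \<noteq> {0} \<and> (\<forall>U. gsubmodule U \<and> U \<subseteq> W \<longrightarrow> U = {0} \<or> U = W)"

definition maximal_gsubmodule :: "('f^'n^'n^'n) set \<Rightarrow> ('f^'n^'n^'n) set \<Rightarrow> bool" where
  "maximal_gsubmodule U W \<longleftrightarrow>
     gsubmodule U \<and> gsubmodule W \<and> U \<subset> W \<and>
     (\<forall>X. gsubmodule X \<and> U \<subseteq> X \<and> X \<subseteq> W \<longrightarrow> X = U \<or> X = W)"

text \<open>A composition series is listed in ascending order, including both ends.\<close>

definition composition_series :: "('f^'n^'n^'n) set list \<Rightarrow> ('f^'n^'n^'n) set \<Rightarrow> bool" where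
  "composition_series Ws W \<longleftrightarrow>
     Ws \<noteq> [] \<and> hd Ws = {0} \<and> last Ws = W \<and>
     (\<forall>i. Suc i < length Ws \<longrightarrow> maximal_gsubmodule (Ws ! i) (Ws ! Suc i))"

definition calC :: "('f^'n^'n^'n) set" where
  "calC = {l. \<forall>x y. alg_prod l x y = alg_prod l y x}"

definition calT :: "('f^'n^'n^'n) set" where
  "calT = {l. \<forall>x. map_trace (alg_prod l x) = 0}"

definition calN :: "('f^'n^'n^'n) set" where
  "calN = calC \<inter> calT"

definition calMss :: "('f^'n^'n^'n) set" where
  "calMss = {l. \<forall>x. alg_prod l x x \<in> span {x}}"

definition calM11 :: "('f^'n^'n^'n) set" where
  "calM11 = {structure_vector (\<lambda>x y. scale (\<theta> y) x + scale (\<theta> x) y) | \<theta>. \<theta> \<in> dual}"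

lemma dim_eq_card: "dim (UNIV :: 'v set) = CARD('n)"
  using dim_eq_card[OF _ independent_basis, of UNIV] span_basis card_image[OF inj_basis]
  by simp

lemma coord_basis: "coord (v i) j = (if j = i then 1 else 0)"
  using representation_basis[OF independent_basis, of "v i"] inj_basis
  by (auto simp: coord_def inj_eq)

lemma coord_add: "coord (x + y) i = coord x i + coord y i"
  using representation_add[OF independent_basis] span_basis by (simp add: coord_def)

lemma coord_scale: "coord (scale c x) i = c * coord x i"
  using representation_scale[OF independent_basis] span_basis by (simp add: coord_def)

lemma sum_coord: "(\<Sum>i\<in>UNIV. scale (coord x i) (v i)) = x"
proof -
  have "(\<Sum>b\<in>range v. scale (representation (range v) x b) b) = x"
    by (rule sum_representation_eq[OF independent_basis]) (auto simp: span_basis)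
  then show ?thesis
    by (simp add: coord_def sum.reindex[OF inj_basis])
qed

lemma alg_prod_basis: "alg_prod l (v i) (v j) = (\<Sum>k\<in>UNIV. scale (l $ i $ j $ k) (v k))"
proof -
  have "alg_prod l (v i) (v j) =
    (\<Sum>i'\<in>UNIV. \<Sum>j'\<in>UNIV. if i' = i then if j' = j then
       \<Sum>k\<in>UNIV. scale (l $ i $ j $ k) (v k) else 0 else 0)"
    unfolding alg_prod_def coord_basis by (intro sum.cong) auto
  also have "\<dots> = (\<Sum>k\<in>UNIV. scale (l $ i $ j $ k) (v k))"
    by (subst sum.swap) simp
  finally show ?thesis .
qed

end

lemma vector_space_lscale: "vector_space (lscale :: 'f::field \<Rightarrow> 'f^'n^'n^'n \<Rightarrow> 'f^'n^'n^'n)"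
  by unfold_locales (simp_all add: lscale_def vec_eq_iff algebra_simps)

end

theory Submission
  imports Defs
begin

text \<open>
  A symmetric product is a quadratic map \<open>u \<mapsto> [u,u]\<close>; write \<open>x\<^sub>a\<^sup>2 v\<^sub>b\<close> for the square of a coordinate
  times a basis vector. If \<open>W\<close> is a submodule not inside \<open>\<M>\<^sup>*\<close>, polarization gives an element
  with a nonzero coefficient at some \<open>x\<^sub>p\<^sup>2 v\<^sub>q\<close>, \<open>p \<noteq> q\<close>. For a third index \<open>r\<close>, the part quadratic
  in \<open>c\<close> of the transvection \<open>v\<^sub>r \<mapsto> v\<^sub>r + c v\<^sub>p\<close> leaves only terms \<open>x\<^sub>r\<^sup>2 v\<^sub>k\<close> and \<open>x\<^sub>r x\<^sub>j v\<^sub>p\<close>;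
  at most two more transvections isolate \<open>x\<^sub>r\<^sup>2 v\<^sub>p\<close>, whose orbit spans \<open>\<N>\<close>. Only the coefficients \<open>\<plusminus>1\<close> are needed, so all fields of characteristic
  other than 2 are treated alike. Both \<open>\<M>\<^sup>*\<close> and \<open>\<C>/\<N>\<close> (via the trace form) are copies of the
  irreducible dual of \<open>V\<close>.
\<close>

text \<open>Entries of the structure vector transformed by \<open>v\<^sub>a \<mapsto> v\<^sub>a + c v\<^sub>b\<close>: \<open>m\<close> is the product of the
  images, and its last index is then mapped back by \<open>v\<^sub>a \<mapsto> v\<^sub>a - c v\<^sub>b\<close>.\<close>

definition transvect :: "'n \<Rightarrow> 'n \<Rightarrow> 'f::field \<Rightarrow> 'f^'n^'n^'n \<Rightarrow> 'f^'n^'n^'n" where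
  "transvect a b c l =
    (let m = (\<lambda>i j k. l $ i $ j $ k + (if i = a then c * l $ b $ j $ k else 0)
        + (if j = a then c * l $ i $ b $ k else 0)
        + (if i = a \<and> j = a then c * c * l $ b $ b $ k else 0))
     in \<chi> i j k. m i j k - (if k = b then c * m i j a else 0))"

text \<open>Structure vector of the product \<open>[u,v] = x(u) x(v) w\<close>, that is, of the
  quadratic map \<open>x^2 w\<close>.\<close>

definition square_tensor :: "('n \<Rightarrow> 'f::field) \<Rightarrow> ('n \<Rightarrow> 'f) \<Rightarrow> 'f^'n^'n^'n" where
  "square_tensor x w = (\<chi> i j k. x i * x j * w k)"

text \<open>Structure vector of \<open>[u,v] = theta(v) u + theta(u) v\<close> for the linear form
  \<open>theta\<close> whose values on the basis are \<open>t\<close>.\<close>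

definition form_tensor :: "('n \<Rightarrow> 'f::field) \<Rightarrow> 'f^'n^'n^'n" where
  "form_tensor t = (\<chi> i j k. (if i = k then t j else 0) + (if j = k then t i else 0))"

definition trace_form :: "'f::field^'n^'n^'n \<Rightarrow> 'n \<Rightarrow> 'f" where
  "trace_form l i = (\<Sum>j\<in>UNIV. l $ i $ j $ j)"

text \<open>Serves both as the coordinate form \<open>x_a\<close> and as the coordinate vector of
  \<open>v_a\<close>.\<close>

definition unit_form :: "'n \<Rightarrow> 'n \<Rightarrow> 'f::field" where
  "unit_form a i = (if i = a then 1 else 0)"

definition covers_in :: "'a::order set \<Rightarrow> 'a \<Rightarrow> 'a \<Rightarrow> bool" where
  "covers_in L a b \<longleftrightarrow> a \<in> L \<and> b \<in> L \<and> a < b \<and> (\<forall>x\<in>L. a \<le> x \<and> x \<le> b \<longrightarrow> x = a \<or> x = b)"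

text \<open>Composition series stripped of their algebra: for \<open>P\<close> equal to
  \<open>maximal_gsubmodule\<close> and \<open>a\<close> equal to \<open>{0}\<close> these are the
  composition series of \<open>c\<close>, which can then be counted by order reasoning
  alone.\<close>

definition chain_lists :: "('a \<Rightarrow> 'a \<Rightarrow> bool) \<Rightarrow> 'a \<Rightarrow> 'a \<Rightarrow> 'a list set" where
  "chain_lists P a c = {ws. ws \<noteq> [] \<and> hd ws = a \<and> last ws = c \<and> successively P ws}"

section \<open>Coordinate formulas for transvections, trace forms and form tensors\<close>

lemma ex_notin_of_card_less:
  assumes "card A < CARD('n)"
  shows "\<exists>x::'n. x \<notin> A"
proof (rule ccontr)
  assume "\<not> ?thesis"
  then have "A = UNIV" by auto
  then show False using assms by simp
qed

lemma lscale_nth [simp]: "lscale c l $ i $ j $ k = c * l $ i $ j $ k"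
  by (simp add: lscale_def)

lemma transvect_nth:
  "transvect a b c l $ i $ j $ k =
    l $ i $ j $ k + (if i = a then c * l $ b $ j $ k else 0)
      + (if j = a then c * l $ i $ b $ k else 0)
      + (if i = a \<and> j = a then c * c * l $ b $ b $ k else 0)
    - (if k = b then c * (l $ i $ j $ a + (if i = a then c * l $ b $ j $ a else 0)
      + (if j = a then c * l $ i $ b $ a else 0)
      + (if i = a \<and> j = a then c * c * l $ b $ b $ a else 0)) else 0)"
  by (simp add: transvect_def)

text \<open>The transvection pulls back the form \<open>x\<close>, and its inverse is applied to the
  vector \<open>w\<close>.\<close>

lemma transvect_square_tensor:
  "transvect a b c (square_tensor x w) =
    square_tensor (\<lambda>i. x i + (if i = a then c * x b else 0)) (\<lambda>k. w k - (if k = b then c * w a else 0))"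
  by (simp add: vec_eq_iff transvect_nth square_tensor_def algebra_simps)

text \<open>The trace is invariant under conjugation, so the trace form is pulled back along the
  transvection like an element of the dual space.\<close>

lemma trace_form_transvect:
  assumes "a \<noteq> b"
  shows "trace_form (transvect a b c l) i = trace_form l i + (if i = a then c * trace_form l b else 0)"
  using assms
  by (simp add: trace_form_def transvect_nth sum.distrib sum_subtractf sum_distrib_left algebra_simps)

lemma trace_form_add: "trace_form (l + m) i = trace_form l i + trace_form m i"
  by (simp add: trace_form_def sum.distrib)

lemma trace_form_diff: "trace_form (l - m) i = trace_form l i - trace_form m i"
  by (simp add: trace_form_def sum_subtractf)

lemma trace_form_lscale: "trace_form (lscale c l) i = c * trace_form l i"
  by (simp add: trace_form_def sum_distrib_left)

lemma trace_form_sum: "trace_form (sum f A) i = (\<Sum>x\<in>A. trace_form (f x) i)"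
  by (induction A rule: infinite_finite_induct) (auto simp: trace_form_add, auto simp: trace_form_def)

text \<open>The map \<open>v -> theta(u) v + theta(v) u\<close> has trace
  \<open>n theta(u) + theta(u)\<close>; this is where \<open>n + 1\<close> enters.\<close>

lemma trace_form_form_tensor:
  "trace_form (form_tensor t :: 'f::field^'n^'n^'n::finite) i = of_nat (CARD('n) + 1) * t i"
  by (simp add: trace_form_def form_tensor_def sum.distrib algebra_simps)

lemma form_tensor_eq_0_iff:
  assumes "(2::'f::field) \<noteq> 0"
  shows "form_tensor t = (0 :: 'f^'n^'n^'n) \<longleftrightarrow> t = (\<lambda>_. 0)"
proof
  assume *: "form_tensor t = (0 :: 'f^'n^'n^'n)"
  have "t i = 0" for i
  proof -
    have "form_tensor t $ i $ i $ i = (0::'f)" using * by simp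
    then have "2 * t i = 0" by (simp add: form_tensor_def)
    then show ?thesis using assms by simp
  qed
  then show "t = (\<lambda>_. 0)" by auto
qed (simp add: form_tensor_def vec_eq_iff)

text \<open>The hypotheses \<open>diag\<close> and \<open>tdiag\<close> say that
  \<open>[u,u]\<close> is a multiple of \<open>u\<close> for \<open>u = v_i\<close> and for
  \<open>u = v_a + c v_b\<close>. Testing \<open>c = 1\<close> and \<open>c = -1\<close> already
  determines every entry from the entries \<open>l $ i $ i $ i\<close>.\<close>

lemma form_tensorI:
  fixes l :: "'f::field^'n^'n^'n"
  assumes two: "(2::'f) \<noteq> 0" and sym: "\<And>i j k. l $ i $ j $ k = l $ j $ i $ k"
    and diag: "\<And>i k. i \<noteq> k \<Longrightarrow> l $ i $ i $ k = 0"
    and tdiag: "\<And>a b c k. a \<noteq> b \<Longrightarrow> a \<noteq> k \<Longrightarrow> transvect a b c l $ a $ a $ k = 0"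
  shows "l = form_tensor (\<lambda>i. l $ i $ i $ i / 2)"
proof -
  have off: "l $ a $ b $ k = 0" if "a \<noteq> b" "k \<noteq> a" "k \<noteq> b" for a b k
  proof -
    have "2 * l $ a $ b $ k = 0"
      using tdiag[of a b k 1] that diag[of a k] diag[of b k] sym[of b a k]
      by (simp add: transvect_nth)
    then show ?thesis using two by simp
  qed
  \<comment> \<open>The sum of the equations for \<open>c = 1\<close> and \<open>c = -1\<close>
    eliminates \<open>l $ a $ a $ a\<close> and \<open>l $ b $ a $ b\<close>.\<close>
  have on: "l $ a $ b $ a = l $ b $ b $ b / 2" if "a \<noteq> b" for a b
  proof -
    have "l $ b $ a $ b + l $ b $ a $ b + l $ b $ b $ b = l $ a $ a $ a + l $ b $ a $ a + l $ b $ a $ a"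
      using tdiag[of a b b 1] that diag[of a b] diag[of b a] sym[of b a b] sym[of b a a]
      by (simp add: transvect_nth algebra_simps)
    moreover have "l $ b $ b $ b + l $ a $ a $ a = l $ b $ a $ b + l $ b $ a $ b + l $ b $ a $ a + l $ b $ a $ a"
      using tdiag[of a b b "-1"] that diag[of a b] diag[of b a] sym[of b a b] sym[of b a a]
      by (simp add: transvect_nth algebra_simps)
    ultimately have "2 * l $ b $ b $ b = 2 * (2 * l $ b $ a $ a)"
      by algebra
    then have "l $ b $ b $ b = 2 * l $ b $ a $ a" using two by (metis mult_left_cancel)
    then show ?thesis using two sym[of a b a] by simp
  qed
  show ?thesis
  proof (simp only: vec_eq_iff, intro allI)
    fix i j k
    show "l $ i $ j $ k = form_tensor (\<lambda>i. l $ i $ i $ i / 2) $ i $ j $ k"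
    proof (cases "i = j")
      case True
      then show ?thesis using two diag[of i k] by (auto simp: form_tensor_def)
    next
      case False
      then show ?thesis using off[of i j k] on[of i j] on[of j i] sym[of i j k]
        by (cases "k = i"; cases "k = j") (auto simp: form_tensor_def)
    qed
  qed
qed

lemma transvect_form_tensor:
  assumes "a \<noteq> b"
  shows "transvect a b c (form_tensor t) = form_tensor (\<lambda>i. t i + (if i = a then c * t b else 0))"
  using assms by (auto simp: vec_eq_iff transvect_nth form_tensor_def algebra_simps)

section \<open>Generating submodules of symmetric structure vectors by transvections\<close>

text \<open>The classification moves elements of a submodule only by transvections between basis
  vectors; the locale records closure under these, entirely in coordinates.\<close>

locale transvection_module =
  fixes W :: "('f::field^'n::finite^'n^'n) set"
  assumes two: "(2::'f) \<noteq> 0"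
    and zero: "0 \<in> W"
    and add: "l \<in> W \<Longrightarrow> m \<in> W \<Longrightarrow> l + m \<in> W"
    and scale: "l \<in> W \<Longrightarrow> lscale c l \<in> W"
    and transvect: "a \<noteq> b \<Longrightarrow> l \<in> W \<Longrightarrow> transvect a b c l \<in> W"
begin

lemma diff: "l \<in> W \<Longrightarrow> m \<in> W \<Longrightarrow> l - m \<in> W"
proof -
  assume "l \<in> W" "m \<in> W"
  then have "l + lscale (-1) m \<in> W" by (intro add scale)
  moreover have "l + lscale (-1) m = l - m" by (simp add: vec_eq_iff)
  ultimately show ?thesis by simp
qed

lemma sum: "(\<And>x. x \<in> A \<Longrightarrow> f x \<in> W) \<Longrightarrow> sum f A \<in> W"
  by (induction A rule: infinite_finite_induct) (auto simp: zero add)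

lemma scale_cancel: "lscale c l \<in> W \<Longrightarrow> c \<noteq> 0 \<Longrightarrow> l \<in> W"
proof -
  assume "lscale c l \<in> W" "c \<noteq> 0"
  then have "lscale (inverse c) (lscale c l) \<in> W" "lscale (inverse c) (lscale c l) = l"
    by (auto intro: scale simp: vec_eq_iff)
  then show ?thesis by simp
qed

lemma square_tensor_from_diagonal:
  assumes l: "l \<in> W" and sym: "\<And>i j k. l $ i $ j $ k = l $ j $ i $ k"
    and pqr: "p \<noteq> q" "p \<noteq> r" "q \<noteq> r" and ne: "l $ p $ p $ q \<noteq> 0"
  shows "square_tensor (unit_form r) (unit_form p) \<in> W"
proof -
  \<comment> \<open>\<open>m\<close> is twice the degree-2 part in \<open>c\<close> of the action of \<open>v\<^sub>r \<mapsto> v\<^sub>r + c v\<^sub>p\<close>.\<close>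
  define m where "m = transvect r p 1 l + transvect r p (-1) l - lscale 2 l"
  \<comment> \<open>The difference along \<open>v_q -> v_q + v_p\<close> leaves only
    \<open>x_r^2 v_p\<close> and \<open>x_r x_q v_p\<close>. If the mixed term survives,
    \<open>w\<close> substitutes \<open>x_q + x_r\<close> for \<open>x_q\<close> and retains just
    \<open>x_r^2 v_p\<close>.\<close>
  define u where "u = transvect q p 1 m - m"
  define w where "w = transvect r q 1 u - u"
  have W: "m \<in> W" "u \<in> W" "w \<in> W"
    using l pqr unfolding m_def u_def w_def by (auto intro!: add diff scale transvect)
  let ?A = "\<lambda>i j k. if k = p \<and> i = r \<and> j = r then 1 else (0::'f)"
  let ?B = "\<lambda>i j k. if k = p \<and> (i = r \<and> j = q \<or> i = q \<and> j = r) then 1 else (0::'f)"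
  have m: "m $ i $ j $ k = 2 * (if i = r \<and> j = r then l $ p $ p $ k else 0)
      - 2 * (if k = p \<and> i = r then l $ p $ j $ r else 0)
      - 2 * (if k = p \<and> j = r then l $ p $ i $ r else 0)" for i j k
    using pqr sym[of i p r] by (auto simp: m_def transvect_nth algebra_simps)
  have u: "u $ i $ j $ k = - 2 * l $ p $ p $ q * ?A i j k - 2 * l $ p $ p $ r * ?B i j k" for i j k
    using pqr by (auto simp: u_def transvect_nth m algebra_simps)
  have w: "w $ i $ j $ k = - 4 * l $ p $ p $ r * ?A i j k" for i j k
    using pqr by (auto simp: w_def transvect_nth u algebra_simps)
  show ?thesis
  proof (cases "l $ p $ p $ r = 0")
    case True
    have "u = lscale (- 2 * l $ p $ p $ q) (square_tensor (unit_form r) (unit_form p))"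
      by (auto simp: vec_eq_iff u True square_tensor_def unit_form_def)
    then show ?thesis using W(2) ne two scale_cancel by auto
  next
    case False
    \<comment> \<open>The factor 4 appears as \<open>2 * 2\<close> so that it is nonzero by
      \<open>two\<close>.\<close>
    have "w = lscale (- (2 * 2) * l $ p $ p $ r) (square_tensor (unit_form r) (unit_form p))"
      by (auto simp: vec_eq_iff w square_tensor_def unit_form_def)
    moreover have "- (2 * 2) * l $ p $ p $ r \<noteq> 0"
      using two False by (metis mult_eq_0_iff neg_equal_0_iff_equal)
    ultimately show ?thesis using W(3) scale_cancel by metis
  qed
qed


text \<open>If no element of \<open>W\<close> had a nonzero entry at some \<open>(p, p, q)\<close>
  with \<open>p \<noteq> q\<close>, then \<open>form_tensorI\<close> would apply to
  \<open>l\<close>, because the transvected copies of \<open>l\<close> also lie in \<open>W\<close>.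
  A third index then makes \<open>square_tensor_from_diagonal\<close> applicable.\<close>

lemma square_tensor_from_nonform:
  assumes l: "l \<in> W" and sym: "\<And>l i j k. l \<in> W \<Longrightarrow> l $ i $ j $ k = l $ j $ i $ k"
    and card: "CARD('n) \<ge> 3" and nonform: "l \<notin> range form_tensor"
  shows "\<exists>r p. r \<noteq> p \<and> square_tensor (unit_form r) (unit_form p) \<in> W"
proof -
  obtain m p q where m: "m \<in> W" "p \<noteq> q" "m $ p $ p $ q \<noteq> 0"
  proof (rule ccontr)
    assume "\<not> thesis"
    then have "m $ p $ p $ q = 0" if "m \<in> W" "p \<noteq> q" for m p q
      using that \<open>\<And>q p m. \<lbrakk>m \<in> W; p \<noteq> q; m $ p $ p $ q \<noteq> 0\<rbrakk> \<Longrightarrow> thesis\<close> by blast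
    then have "l = form_tensor (\<lambda>i. l $ i $ i $ i / 2)"
      using l sym transvect two by (intro form_tensorI) auto
    then show False using nonform by blast
  qed
  obtain r where "r \<notin> {p, q}"
    using ex_notin_of_card_less[of "{p, q}"] card by (cases "p = q") auto
  then show ?thesis using square_tensor_from_diagonal[of m p q r] m sym by blast
qed

text \<open>Second difference along the transvections of \<open>v_c\<close> by plus or minus
  \<open>v_a\<close>: \<open>(x_a + x_c)^2 + (x_a - x_c)^2 - 2 x_a^2 = 2 x_c^2\<close>, while
  \<open>v_b\<close> stays fixed.\<close>

lemma square_tensor_move_left:
  assumes "a \<noteq> b" "c \<noteq> b" and in_W: "square_tensor (unit_form a) (unit_form b) \<in> W"
  shows "square_tensor (unit_form c) (unit_form b) \<in> W"
proof (cases "a = c")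
  case False
  let ?s = "square_tensor (unit_form a) (unit_form b) :: 'f^'n^'n^'n"
  have "transvect c a 1 ?s + transvect c a (-1) ?s - lscale 2 ?s \<in> W"
    using in_W False by (intro add diff scale transvect) auto
  moreover have "transvect c a 1 ?s + transvect c a (-1) ?s - lscale 2 ?s
      = lscale 2 (square_tensor (unit_form c) (unit_form b))"
    using assms False
    by (simp add: transvect_square_tensor) (auto simp: vec_eq_iff square_tensor_def unit_form_def)
  ultimately show ?thesis using scale_cancel two by metis
qed (use in_W in simp)

text \<open>The inverse of \<open>v_b -> v_b + v_c\<close> sends \<open>v_b\<close> to
  \<open>v_b - v_c\<close> and leaves the form \<open>x_a\<close> alone.\<close>

lemma square_tensor_move_right:
  assumes "a \<noteq> b" "a \<noteq> c" and in_W: "square_tensor (unit_form a) (unit_form b) \<in> W"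
  shows "square_tensor (unit_form a) (unit_form c) \<in> W"
proof (cases "b = c")
  case False
  let ?s = "square_tensor (unit_form a) (unit_form b) :: 'f^'n^'n^'n"
  have "?s - transvect b c 1 ?s \<in> W"
    using in_W False by (intro diff transvect) auto
  moreover have "?s - transvect b c 1 ?s = square_tensor (unit_form a) (unit_form c)"
    using assms False
    by (simp add: transvect_square_tensor) (auto simp: vec_eq_iff square_tensor_def unit_form_def)
  ultimately show ?thesis by metis
qed (use in_W in simp)

text \<open>The route is \<open>(a, b)\<close>, \<open>(r, b)\<close>, \<open>(r, d)\<close>,
  \<open>(c, d)\<close>; the third index \<open>r\<close> keeps the two entries distinct at every
  stage.\<close>

lemma square_tensor_all:
  assumes card: "CARD('n) \<ge> 3" and "a \<noteq> b" "square_tensor (unit_form a) (unit_form b) \<in> W"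
    and "c \<noteq> d"
  shows "square_tensor (unit_form c) (unit_form d) \<in> W"
proof -
  obtain r where "r \<notin> {b, d}"
    using ex_notin_of_card_less[of "{b, d}"] card by (cases "b = d") auto
  then show ?thesis
    using assms square_tensor_move_left[of a b r] square_tensor_move_right[of r b d]
      square_tensor_move_left[of r d c] by blast
qed

lemma trace_zero_generated:
  assumes sq: "\<And>a b. a \<noteq> b \<Longrightarrow> square_tensor (unit_form a) (unit_form b) \<in> W"
    and sym: "\<And>i j k. l $ i $ j $ k = l $ j $ i $ k"
    and tr: "\<And>i. trace_form l i = 0"
  shows "l \<in> W"
proof -
  let ?Q = "\<lambda>a b. square_tensor (unit_form a) (unit_form b) :: 'f^'n^'n^'n"
  \<comment> \<open>\<open>2 l\<close> is the combination of the symmetrized units \<open>S i j k\<close> with coefficients \<open>l $ i $ j $ k\<close>; the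
    corrections in \<open>B i j k\<close> put each term into \<open>W\<close> and cancel in the sum since the traces of \<open>l\<close> vanish.\<close>
  define S :: "'n \<Rightarrow> 'n \<Rightarrow> 'n \<Rightarrow> 'f^'n^'n^'n" where
    "S = (\<lambda>i j k. \<chi> p q r. (unit_form i p * unit_form j q + unit_form j p * unit_form i q) * unit_form k r)"
  define B where
    "B = (\<lambda>i j k. S i j k - lscale ((if k = j then 1 else 0) / 2) (S i i i)
        - lscale ((if k = i then 1 else 0) / 2) (S j j j))"
  have S_sym: "S i j k = S j i k" for i j k
    by (simp add: S_def vec_eq_iff algebra_simps)
  have S_off: "S i j k \<in> W" if "k \<noteq> i" "k \<noteq> j" for i j k
  proof (cases "i = j")
    case True
    then have "S i j k = lscale 2 (?Q i k)"
      by (auto simp: S_def vec_eq_iff square_tensor_def unit_form_def)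
    then show ?thesis using sq that scale by metis
  next
    case False
    \<comment> \<open>Polarization \<open>(x_i + x_j)^2 - x_i^2 - x_j^2 = 2 x_i x_j\<close>, with
      \<open>v_k\<close> fixed by the transvection.\<close>
    have "transvect j i 1 (?Q i k) - ?Q i k - ?Q j k \<in> W"
      using that False sq by (intro diff transvect) auto
    moreover have "transvect j i 1 (?Q i k) - ?Q i k - ?Q j k = S i j k"
      using that False
      by (simp add: transvect_square_tensor)
        (auto simp: vec_eq_iff square_tensor_def unit_form_def S_def)
    ultimately show ?thesis by metis
  qed
  have S_on: "S i j j - lscale (1 / 2) (S i i i) \<in> W" if "i \<noteq> j" for i j
  proof -
    \<comment> \<open>As quadratic maps,
      \<open>(x_i + x_j)^2 (v_j - v_i) - (x_i - x_j)^2 (v_j + v_i)\<close> equals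
      \<open>4 x_i x_j v_j - 2 (x_i^2 + x_j^2) v_i\<close>; adding \<open>2 x_j^2 v_i\<close>
      removes the unwanted square.\<close>
    have "transvect j i 1 (?Q i j) - transvect j i (-1) (?Q i j) + lscale 2 (?Q j i) \<in> W"
      using that sq by (intro diff add scale transvect) auto
    moreover have "transvect j i 1 (?Q i j) - transvect j i (-1) (?Q i j) + lscale 2 (?Q j i)
        = lscale 2 (S i j j - lscale (1 / 2) (S i i i))"
      using that two
      by (simp add: transvect_square_tensor)
        (auto simp: vec_eq_iff square_tensor_def unit_form_def S_def field_simps)
    ultimately show ?thesis using scale_cancel two by metis
  qed
  have B: "B i j k \<in> W" for i j k
  proof (cases "i = j")
    case True
    \<comment> \<open>For \<open>i = j = k\<close> both corrections apply, each removing half, so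
      \<open>B i i i\<close> vanishes.\<close>
    have "S i i i - lscale (1 / 2) (S i i i) - lscale (1 / 2) (S i i i) = 0"
      using two by (simp add: vec_eq_iff field_simps)
    moreover have "lscale 0 m = 0" for m :: "'f^'n^'n^'n" by (simp add: vec_eq_iff)
    ultimately show ?thesis using True S_off[of k i i] zero by (auto simp: B_def)
  next
    case False
    moreover have "lscale 0 m = 0" for m :: "'f^'n^'n^'n" by (simp add: vec_eq_iff)
    ultimately show ?thesis using S_off[of k i j] S_on[of i j] S_on[of j i]
      by (auto simp: B_def S_sym[of j i])
  qed
  have "(\<Sum>i\<in>UNIV. \<Sum>j\<in>UNIV. \<Sum>k\<in>UNIV. lscale (l $ i $ j $ k) (B i j k)) \<in> W"
    by (intro sum scale B)
  moreover have "(\<Sum>i\<in>UNIV. \<Sum>j\<in>UNIV. \<Sum>k\<in>UNIV. lscale (l $ i $ j $ k) (B i j k)) = lscale 2 l"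
  proof (simp only: vec_eq_iff, intro allI)
    fix p q r
    have S: "(\<Sum>i\<in>UNIV. \<Sum>j\<in>UNIV. \<Sum>k\<in>UNIV. l $ i $ j $ k * S i j k $ p $ q $ r) = 2 * l $ p $ q $ r"
    proof -
      have "(\<Sum>k\<in>UNIV. l $ i $ j $ k * S i j k $ p $ q $ r)
          = (if i = p then if j = q then l $ i $ j $ r else 0 else 0)
            + (if i = q then if j = p then l $ i $ j $ r else 0 else 0)" for i j
      proof -
        have "(\<Sum>k\<in>UNIV. l $ i $ j $ k * S i j k $ p $ q $ r)
          = (\<Sum>k\<in>UNIV. if k = r then
              (if i = p then if j = q then l $ i $ j $ r else 0 else 0)
              + (if i = q then if j = p then l $ i $ j $ r else 0 else 0) else 0)"
          by (intro sum.cong) (auto simp: S_def unit_form_def)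
        then show ?thesis by simp
      qed
      moreover have "(\<Sum>i\<in>UNIV. \<Sum>j\<in>UNIV.
            (if i = a then if j = b then l $ i $ j $ r else 0 else 0)) = l $ a $ b $ r" for a b
        by (subst sum.swap) simp
      ultimately show ?thesis using sym[of q p r] by (simp add: sum.distrib)
    qed
    have left: "(\<Sum>i\<in>UNIV. \<Sum>j\<in>UNIV. \<Sum>k\<in>UNIV.
        l $ i $ j $ k * ((if k = j then 1 else 0) / 2 * S i i i $ p $ q $ r)) = 0"
    proof -
      have "(\<Sum>k\<in>UNIV. l $ i $ j $ k * ((if k = j then 1 else 0) / 2 * S i i i $ p $ q $ r))
          = l $ i $ j $ j * (S i i i $ p $ q $ r / 2)" for i j
      proof -
        have "(\<Sum>k\<in>UNIV. l $ i $ j $ k * ((if k = j then 1 else 0) / 2 * S i i i $ p $ q $ r))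
          = (\<Sum>k\<in>UNIV. if k = j then l $ i $ j $ j * (S i i i $ p $ q $ r / 2) else 0)"
          by (intro sum.cong) auto
        then show ?thesis by simp
      qed
      moreover have "(\<Sum>j\<in>UNIV. l $ i $ j $ j * c) = 0" for i c
        using tr[of i] by (simp flip: sum_distrib_right add: trace_form_def)
      ultimately show ?thesis by (simp only: sum.neutral_const)
    qed
    have right: "(\<Sum>i\<in>UNIV. \<Sum>j\<in>UNIV. \<Sum>k\<in>UNIV.
        l $ i $ j $ k * ((if k = i then 1 else 0) / 2 * S j j j $ p $ q $ r)) = 0"
      using left by (subst sum.swap) (simp only: sym)
    show "(\<Sum>i\<in>UNIV. \<Sum>j\<in>UNIV. \<Sum>k\<in>UNIV. lscale (l $ i $ j $ k) (B i j k)) $ p $ q $ r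
        = lscale 2 l $ p $ q $ r"
      using S left right by (simp add: B_def right_diff_distrib sum_subtractf)
  qed
  ultimately show ?thesis using scale_cancel two by metis
qed

text \<open>The transvection \<open>v_a -> v_a + v_b\<close> changes \<open>t\<close> only at
  \<open>a\<close>, by \<open>t b\<close>. The difference is a nonzero multiple of a unit form, and
  the unit forms span.\<close>

lemma form_tensors_generated:
  assumes "CARD('n) \<ge> 2" and W: "form_tensor t \<in> W" and t: "t b \<noteq> 0"
  shows "form_tensor s \<in> W"
proof -
  have step: "form_tensor (unit_form a) \<in> W" if "form_tensor t \<in> W" "t b \<noteq> 0" "a \<noteq> b" for a b t
  proof -
    have "transvect a b 1 (form_tensor t) - form_tensor t \<in> W"
      using that by (intro diff transvect)
    moreover have "transvect a b 1 (form_tensor t) - form_tensor t = lscale (t b) (form_tensor (unit_form a))"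
      using that by (simp add: transvect_form_tensor)
        (auto simp: vec_eq_iff form_tensor_def unit_form_def)
    ultimately show ?thesis using scale_cancel that by metis
  qed
  obtain a where "a \<noteq> b"
    using ex_notin_of_card_less[of "{b}"] assms(1) by auto
  \<comment> \<open>The index \<open>b\<close> itself is reached from \<open>unit_form a\<close>,
    with the roles of \<open>a\<close> and \<open>b\<close> exchanged.\<close>
  then have "form_tensor (unit_form b) \<in> W"
    using step[OF W t] step[of "unit_form a" a b] by (auto simp: unit_form_def)
  then have "form_tensor (unit_form i) \<in> W" for i
    using step[OF W t] by metis
  then have "(\<Sum>i\<in>UNIV. lscale (s i) (form_tensor (unit_form i))) \<in> W"
    by (intro sum scale)
  moreover have "(\<Sum>i\<in>UNIV. lscale (s i) (form_tensor (unit_form i))) = form_tensor s"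
  proof (simp only: vec_eq_iff, intro allI)
    fix i j k
    have "s a * form_tensor (unit_form a) $ i $ j $ k = (if a = j then if i = k then s j else 0 else 0)
        + (if a = i then if j = k then s i else 0 else 0)" for a
      by (auto simp: form_tensor_def unit_form_def)
    then show "(\<Sum>a\<in>UNIV. lscale (s a) (form_tensor (unit_form a))) $ i $ j $ k = form_tensor s $ i $ j $ k"
      by (simp add: sum.distrib) (simp add: form_tensor_def)
  qed
  ultimately show ?thesis by metis
qed

text \<open>The argument of \<open>form_tensors_generated\<close>, carried out on trace forms:
  differences along transvections give elements of \<open>W\<close> with every unit form as trace
  form. A combination \<open>?d\<close> of them has the trace form of \<open>s\<close>, and
  \<open>s - ?d\<close> lies in \<open>W\<close> by \<open>N\<close>.\<close>

lemma trace_zero_maximal: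
  assumes "CARD('n) \<ge> 2" and W: "l \<in> W" and l: "trace_form l b \<noteq> 0"
    and sym: "\<And>l i j k. l \<in> W \<Longrightarrow> l $ i $ j $ k = l $ j $ i $ k"
    and N: "\<And>m. (\<And>i j k. m $ i $ j $ k = m $ j $ i $ k) \<Longrightarrow> (\<And>i. trace_form m i = 0) \<Longrightarrow> m \<in> W"
    and s_sym: "\<And>i j k. s $ i $ j $ k = s $ j $ i $ k"
  shows "s \<in> W"
proof -
  have step: "\<exists>m\<in>W. \<forall>i. trace_form m i = unit_form a i" if "l \<in> W" "trace_form l b \<noteq> 0" "a \<noteq> b" for a b l
  proof -
    let ?m = "lscale (inverse (trace_form l b)) (transvect a b 1 l - l)"
    have "?m \<in> W"
      using that by (intro diff transvect scale)
    moreover have "trace_form ?m i = unit_form a i" for i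
      using that by (simp add: trace_form_lscale trace_form_diff trace_form_transvect unit_form_def)
    ultimately show ?thesis by blast
  qed
  obtain a where "a \<noteq> b"
    using ex_notin_of_card_less[of "{b}"] assms(1) by auto
  then obtain m where "m \<in> W" "\<forall>i. trace_form m i = unit_form a i"
    using step[OF W l] by blast
  then have "\<exists>m\<in>W. \<forall>i. trace_form m i = unit_form b i"
    using step[of m a b] \<open>a \<noteq> b\<close> by (auto simp: unit_form_def)
  then have "\<forall>a. \<exists>m\<in>W. \<forall>i. trace_form m i = unit_form a i"
    using step[OF W l] by metis
  then obtain m where m: "\<And>a. m a \<in> W" "\<And>a i. trace_form (m a) i = unit_form a i"
    by metis
  let ?d = "\<Sum>a\<in>UNIV. lscale (trace_form s a) (m a)"
  have d: "?d \<in> W" by (intro sum scale m)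
  moreover have "s - ?d \<in> W"
  proof (rule N)
    show "(s - ?d) $ i $ j $ k = (s - ?d) $ j $ i $ k" for i j k
      using s_sym sym[OF d] by simp
    show "trace_form (s - ?d) i = 0" for i
      by (simp add: trace_form_diff trace_form_sum trace_form_lscale m unit_form_def mult_delta_left mult_delta_right)
  qed
  ultimately have "?d + (s - ?d) \<in> W" by (rule add)
  then show ?thesis by simp
qed

end


section \<open>Counting maximal chains in an order with four elements\<close>

lemma successively_imp_le_last:
  fixes P :: "'a::order \<Rightarrow> 'a \<Rightarrow> bool"
  assumes P: "\<And>x y. P x y \<Longrightarrow> x < y" and "successively P (x # xs)"
  shows "x \<le> last (x # xs)"
  using assms(2)
proof (induction xs arbitrary: x)
  case (Cons y ys)
  then have "x < y" "y \<le> last (y # ys)" using P[of x y] by simp_all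
  then show ?case by simp
qed simp

lemma chain_lists_self:
  fixes P :: "'a::order \<Rightarrow> 'a \<Rightarrow> bool"
  assumes P: "\<And>x y. P x y \<Longrightarrow> x < y"
  shows "chain_lists P c c = {[c]}"
proof -
  have "ws = [c]" if ws: "ws \<in> chain_lists P c c" for ws
  proof (cases ws)
    case (Cons x xs)
    show ?thesis
    proof (cases xs)
      case (Cons y ys)
      with ws \<open>ws = x # xs\<close> have "P c y" "successively P (y # ys)" "last (y # ys) = c"
        by (auto simp: chain_lists_def)
      then have False using P[of c y] successively_imp_le_last[of P y ys, OF P] by simp
      then show ?thesis ..
    qed (use ws Cons in \<open>simp add: chain_lists_def\<close>)
  qed (use ws in \<open>simp add: chain_lists_def\<close>)
  moreover have "[c] \<in> chain_lists P c c" by (simp add: chain_lists_def)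
  ultimately show ?thesis by blast
qed

text \<open>Recursion on the first step of the chain. The bound \<open>b \<le> c\<close>, automatic
  for an increasing chain, is kept because \<open>maximal_gsubmodule_in_calC\<close> speaks only of
  submodules inside \<open>calC\<close>.\<close>

lemma chain_lists_step:
  fixes P :: "'a::order \<Rightarrow> 'a \<Rightarrow> bool"
  assumes P: "\<And>x y. P x y \<Longrightarrow> x < y" and "a \<noteq> c"
  shows "chain_lists P a c = (\<Union>b\<in>{b. P a b \<and> b \<le> c}. (#) a ` chain_lists P b c)"
proof (intro subset_antisym subsetI)
  fix ws assume ws: "ws \<in> chain_lists P a c"
  then obtain xs where "ws = a # xs" by (cases ws) (auto simp: chain_lists_def)
  with ws assms(2) obtain b ys where b: "ws = a # b # ys" by (cases xs) (auto simp: chain_lists_def)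
  with ws have "P a b" "b # ys \<in> chain_lists P b c"
    by (simp_all add: chain_lists_def)
  moreover from this have "b \<le> c"
    using successively_imp_le_last[of P b ys, OF P] by (simp only: chain_lists_def mem_Collect_eq)
  ultimately show "ws \<in> (\<Union>b\<in>{b. P a b \<and> b \<le> c}. (#) a ` chain_lists P b c)"
    using b by blast
next
  fix ws assume "ws \<in> (\<Union>b\<in>{b. P a b \<and> b \<le> c}. (#) a ` chain_lists P b c)"
  then obtain b xs where "P a b" "ws = a # xs" "xs \<in> chain_lists P b c" by blast
  then show "ws \<in> chain_lists P a c"
    by (cases xs) (auto simp: chain_lists_def)
qed

text \<open>The lattice when the characteristic divides \<open>n + 1\<close>; \<open>z\<close>,
  \<open>m\<close>, \<open>n\<close>, \<open>c\<close> stand for \<open>{0}\<close>,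
  \<open>calM11\<close>, \<open>calN\<close>, \<open>calC\<close>.\<close>

lemma covers_in_chain:
  assumes "z < m" "m < n" "n < c"
  shows "{b. covers_in {z, m, n, c} z b} = {m}" "{b. covers_in {z, m, n, c} m b} = {n}"
    "{b. covers_in {z, m, n, c} n b} = {c}"
proof -
  have "z < n" "m < c" "z < c" using assms by order+
  note less = assms this
  note table = less less[THEN less_imp_le] less[THEN less_imp_neq] less[THEN less_imp_neq, THEN not_sym]
    less[THEN less_le_not_le[THEN iffD1], THEN conjunct2] less[THEN less_not_sym]
  show "{b. covers_in {z, m, n, c} z b} = {m}" "{b. covers_in {z, m, n, c} m b} = {n}"
    "{b. covers_in {z, m, n, c} n b} = {c}"
    unfolding covers_in_def by (auto simp: table)
qed

text \<open>The lattice in the other case, where \<open>calM11\<close> and \<open>calN\<close> are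
  incomparable.\<close>

lemma covers_in_square:
  assumes "z < m" "z < n" "m < c" "n < c" "\<not> m \<le> n" "\<not> n \<le> m"
  shows "{b. covers_in {z, m, n, c} z b} = {m, n}" "{b. covers_in {z, m, n, c} m b} = {c}"
    "{b. covers_in {z, m, n, c} n b} = {c}"
proof -
  have "z < c" "m \<noteq> n" "n \<noteq> m" "\<not> m < n" "\<not> n < m" using assms by order+
  note less = assms(1-4) this(1)
  note table = less less[THEN less_imp_le] less[THEN less_imp_neq] less[THEN less_imp_neq, THEN not_sym]
    less[THEN less_le_not_le[THEN iffD1], THEN conjunct2] less[THEN less_not_sym]
    assms(5,6) \<open>m \<noteq> n\<close> \<open>n \<noteq> m\<close> \<open>\<not> m < n\<close> \<open>\<not> n < m\<close>
  show "{b. covers_in {z, m, n, c} z b} = {m, n}" "{b. covers_in {z, m, n, c} m b} = {c}"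
    "{b. covers_in {z, m, n, c} n b} = {c}"
    unfolding covers_in_def by (auto simp: table)
qed

section \<open>Coordinates and the action of the general linear group\<close>

context based_vector_space
begin

lemma two_nonzero:
  assumes "CHAR('f) \<noteq> 2"
  shows "(2::'f) \<noteq> 0"
proof
  assume "(2::'f) = 0"
  then have "of_nat 2 = (0::'f)" by simp
  then have dvd: "CHAR('f) dvd 2" by (simp only: of_nat_eq_0_iff_char_dvd)
  then have "CHAR('f) \<le> 2" by (rule dvd_imp_le) simp
  moreover have "CHAR('f) \<noteq> 0" using dvd by (metis dvd_0_left_iff zero_neq_numeral)
  moreover have "CHAR('f) \<noteq> 1" by simp
  ultimately show False using assms by arith
qed

lemma coord_sum: "coord (sum f A) i = (\<Sum>x\<in>A. coord (f x) i)"
proof -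
  have "coord 0 i = 0" using coord_scale[of 0 0 i] by simp
  then show ?thesis
    by (induction A rule: infinite_finite_induct) (auto simp: coord_add)
qed

lemma coord_diff: "coord (x - y) i = coord x i - coord y i"
  using coord_add[of "x - y" y i] by simp

lemma vector_eqI:
  assumes "\<And>i. coord x i = coord y i"
  shows "x = y"
proof -
  have "x = (\<Sum>i\<in>UNIV. scale (coord x i) (v i))" by (rule sum_coord[symmetric])
  also have "\<dots> = (\<Sum>i\<in>UNIV. scale (coord y i) (v i))" by (simp only: assms)
  also have "\<dots> = y" by (rule sum_coord)
  finally show ?thesis .
qed

lemma coord_alg_prod:
  "coord (alg_prod l x y) k = (\<Sum>i\<in>UNIV. \<Sum>j\<in>UNIV. coord x i * coord y j * l $ i $ j $ k)"
  by (simp add: alg_prod_def coord_sum coord_scale coord_basis mult_delta_left mult_delta_right)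

lemma coord_alg_prod_basis: "coord (alg_prod l (v i) (v j)) k = l $ i $ j $ k"
  by (simp add: alg_prod_basis coord_sum coord_scale coord_basis mult_delta_left mult_delta_right)

lemma alg_prod_add_left: "alg_prod l (x + y) z = alg_prod l x z + alg_prod l y z"
  by (rule vector_eqI) (simp add: coord_alg_prod coord_add algebra_simps sum.distrib)

lemma alg_prod_add_right: "alg_prod l x (y + z) = alg_prod l x y + alg_prod l x z"
  by (rule vector_eqI) (simp add: coord_alg_prod coord_add algebra_simps sum.distrib)

lemma alg_prod_scale_left: "alg_prod l (scale c x) y = scale c (alg_prod l x y)"
  by (rule vector_eqI) (simp add: coord_alg_prod coord_scale sum_distrib_left algebra_simps)

lemma alg_prod_scale_right: "alg_prod l x (scale c y) = scale c (alg_prod l x y)"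
  by (rule vector_eqI) (simp add: coord_alg_prod coord_scale sum_distrib_left algebra_simps)

lemma linear_sum_scale:
  assumes "Vector_Spaces.linear scale scale' f"
  shows "f (\<Sum>i\<in>A. scale (c i) (x i)) = (\<Sum>i\<in>A. scale' (c i) (f (x i)))"
proof -
  have f: "f (x + y) = f x + f y" "f (scale c x) = scale' c (f x)" for c x y
    using assms by (auto simp: Vector_Spaces.linear_iff)
  moreover have "f 0 = 0" using f(1)[of 0 0] by simp
  ultimately show ?thesis
    by (induction A rule: infinite_finite_induct) auto
qed

lemma linear_expand:
  assumes "Vector_Spaces.linear scale scale f"
  shows "f x = (\<Sum>i\<in>UNIV. scale (coord x i) (f (v i)))"
  using linear_sum_scale[OF assms, of "coord x" v UNIV] by (simp add: sum_coord)

lemma alg_prod_structure_vector: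
  assumes l: "\<And>y. Vector_Spaces.linear scale scale (\<lambda>x. b x y)"
    and r: "\<And>x. Vector_Spaces.linear scale scale (b x)"
  shows "alg_prod (structure_vector b) x y = b x y"
proof (rule vector_eqI)
  fix k
  have "b x y = (\<Sum>i\<in>UNIV. scale (coord x i) (\<Sum>j\<in>UNIV. scale (coord y j) (b (v i) (v j))))"
    using linear_expand[OF l, of x y] linear_expand[OF r, of "v _" y] by simp
  then show "coord (alg_prod (structure_vector b) x y) k = coord (b x y) k"
    by (simp add: coord_alg_prod structure_vector_def coord_sum coord_scale sum_distrib_left mult.assoc)
qed

lemma GL_D:
  assumes "g \<in> GL"
  shows "Vector_Spaces.linear scale scale g" "g (x + y) = g x + g y" "g (scale c x) = scale c (g x)"
    "g (inv g x) = x" "inv g (g x) = x"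
    "inv g (x + y) = inv g x + inv g y" "inv g (scale c x) = scale c (inv g x)"
    "Vector_Spaces.linear scale scale (inv g)"
proof -
  have g: "Vector_Spaces.linear scale scale g" "bij g" using assms by (auto simp: GL_def)
  then show lin: "g (x + y) = g x + g y" "g (scale c x) = scale c (g x)" for c x y
    by (auto simp: Vector_Spaces.linear_iff)
  show inv: "g (inv g x) = x" "inv g (g x) = x" for x
    using g(2) by (auto simp: bij_def surj_f_inv_f)
  show ilin: "inv g (x + y) = inv g x + inv g y" "inv g (scale c x) = scale c (inv g x)" for c x y
  proof -
    have "inv g (x + y) = inv g (g (inv g x + inv g y))" by (simp only: lin inv)
    then show "inv g (x + y) = inv g x + inv g y" by (simp only: inv)
    have "inv g (scale c x) = inv g (g (scale c (inv g x)))" by (simp only: lin inv)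
    then show "inv g (scale c x) = scale c (inv g x)" by (simp only: inv)
  qed
  show "Vector_Spaces.linear scale scale (inv g)" "Vector_Spaces.linear scale scale g"
    using ilin lin vector_space_axioms by (auto simp: Vector_Spaces.linear_iff)
qed

text \<open>\<open>act\<close> records the new product on basis vectors only; bilinearity extends
  the formula to all of \<open>V\<close>.\<close>

lemma alg_prod_act:
  assumes "g \<in> GL"
  shows "alg_prod (act l g) x y = inv g (alg_prod l (g x) (g y))"
  unfolding act_def
proof (rule alg_prod_structure_vector)
  note lin = alg_prod_add_left alg_prod_add_right alg_prod_scale_left alg_prod_scale_right
    GL_D(2,3,6,7)[OF assms]
  show "Vector_Spaces.linear scale scale (\<lambda>x. inv g (alg_prod l (g x) (g y)))" for y
    using vector_space_axioms by (simp add: Vector_Spaces.linear_iff lin)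
  show "Vector_Spaces.linear scale scale (\<lambda>y. inv g (alg_prod l (g x) (g y)))" for x
    using vector_space_axioms by (simp add: Vector_Spaces.linear_iff lin)
qed

lemma act_zero:
  assumes "g \<in> GL"
  shows "act 0 g = 0"
proof -
  have "alg_prod 0 x y = 0" for x y by (simp add: alg_prod_def)
  moreover have "inv g 0 = 0" using GL_D(6)[OF assms, of 0 0] by simp
  moreover have "coord 0 i = 0" for i using coord_scale[of 0 0 i] by simp
  ultimately show ?thesis by (simp add: act_def structure_vector_def vec_eq_iff)
qed

lemma gsubmodule_iff:
  "gsubmodule W \<longleftrightarrow> 0 \<in> W \<and> (\<forall>l\<in>W. \<forall>m\<in>W. l + m \<in> W) \<and> (\<forall>c. \<forall>l\<in>W. lscale c l \<in> W)
     \<and> (\<forall>g\<in>GL. \<forall>l\<in>W. act l g \<in> W)"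
proof -
  have "module (lscale :: 'f \<Rightarrow> _ \<Rightarrow> 'f^'n^'n^'n)"
    by (simp add: vector_space_lscale module_iff_vector_space)
  from module.subspace_def[OF this] show ?thesis
    unfolding gsubmodule_def by (simp only: conj_assoc)
qed

text \<open>The witness adds \<open>c x_a v_b\<close> to \<open>x\<close>. Subtracting the same term
  inverts it, because \<open>v_b\<close> has zero coordinate at \<open>a\<close>.\<close>

lemma act_transvection:
  fixes c :: 'f
  assumes "a \<noteq> b"
  shows "\<exists>g\<in>GL. \<forall>l. act l g = transvect a b c l"
proof (intro bexI allI)
  define g where "g = (\<lambda>x. x + scale (c * coord x a) (v b))"
  define h where "h = (\<lambda>x. x - scale (c * coord x a) (v b))"
  have "g (h x) = x" "h (g x) = x" for x
    using assms(1) by (simp_all add: g_def h_def coord_add coord_diff coord_scale coord_basis)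
  then have g: "bij g" "inv g = h"
    by (auto intro!: o_bij[of h] inv_equality)
  show "g \<in> GL"
    using g vector_space_axioms
    by (auto simp: GL_def Vector_Spaces.linear_iff g_def coord_add coord_scale algebra_simps)
  have gv: "g (v i) = v i + scale (if i = a then c else 0) (v b)" for i
    by (auto simp: g_def coord_basis)
  show "act l g = transvect a b c l" for l
    unfolding vec_eq_iff act_def structure_vector_def g h_def gv
    by (auto simp: transvect_nth alg_prod_add_left alg_prod_add_right alg_prod_scale_left
        alg_prod_scale_right coord_diff coord_add coord_scale coord_basis coord_alg_prod_basis
        algebra_simps)
qed

lemma gsubmodule_transvection_module:
  assumes "gsubmodule W" "CHAR('f) \<noteq> 2"
  shows "transvection_module W"
proof
  show "transvect a b c l \<in> W" if "a \<noteq> b" "l \<in> W" for a b c l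
    using act_transvection[OF that(1)] assms(1) that(2) unfolding gsubmodule_iff by metis
qed (use assms two_nonzero in \<open>auto simp: gsubmodule_iff\<close>)

section \<open>The submodules \<open>calC\<close>, \<open>calN\<close> and
  \<open>calM11\<close>\<close>

lemma calC_iff: "l \<in> calC \<longleftrightarrow> (\<forall>i j k. l $ i $ j $ k = l $ j $ i $ k)"
proof
  assume "l \<in> calC"
  then have "coord (alg_prod l (v i) (v j)) k = coord (alg_prod l (v j) (v i)) k" for i j k
    by (simp add: calC_def)
  then show "\<forall>i j k. l $ i $ j $ k = l $ j $ i $ k"
    by (simp add: coord_alg_prod_basis)
next
  assume *: "\<forall>i j k. l $ i $ j $ k = l $ j $ i $ k"
  have "coord (alg_prod l x y) k = coord (alg_prod l y x) k" for x y k
    unfolding coord_alg_prod by (subst sum.swap) (use * in \<open>simp add: mult.commute\<close>)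
  then show "l \<in> calC" unfolding calC_def using vector_eqI by blast
qed

lemma map_trace_eq: "map_trace f = (\<Sum>j\<in>UNIV. coord (f (v j)) j)"
  by (simp add: map_trace_def trace_def)

lemma calT_iff: "l \<in> calT \<longleftrightarrow> (\<forall>i. trace_form l i = 0)"
proof -
  have "map_trace (alg_prod l x) = (\<Sum>i\<in>UNIV. coord x i * trace_form l i)" for x
  proof -
    have "map_trace (alg_prod l x) = (\<Sum>j\<in>UNIV. \<Sum>i\<in>UNIV. coord x i * l $ i $ j $ j)"
      unfolding map_trace_eq
      by (simp add: coord_alg_prod coord_basis mult_delta_left mult_delta_right)
    also have "\<dots> = (\<Sum>i\<in>UNIV. coord x i * trace_form l i)"
      by (subst sum.swap) (simp add: trace_form_def sum_distrib_left)
    finally show ?thesis .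
  qed
  note tr = this
  have "map_trace (alg_prod l (v i)) = trace_form l i" for i
    by (simp add: map_trace_eq coord_alg_prod_basis trace_form_def)
  then show ?thesis using tr by (auto simp: calT_def)
qed

lemma map_trace_commute:
  assumes "Vector_Spaces.linear scale scale f" "Vector_Spaces.linear scale scale g"
  shows "map_trace (f \<circ> g) = map_trace (g \<circ> f)"
proof -
  have "map_trace (f \<circ> g) = (\<Sum>j\<in>UNIV. \<Sum>i\<in>UNIV. coord (g (v j)) i * coord (f (v i)) j)"
    if f: "Vector_Spaces.linear scale scale f" for f g
    unfolding map_trace_eq by (simp add: linear_expand[OF f, of "g _"] coord_sum coord_scale)
  from this[OF assms(1), of g] this[OF assms(2), of f] show ?thesis
    by (subst (asm) sum.swap) (simp add: mult.commute)
qed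

lemma gsubmodule_calC: "gsubmodule calC"
proof -
  have "act l g \<in> calC" if "g \<in> GL" "l \<in> calC" for l g
    using that by (auto simp: calC_def alg_prod_act)
  then show ?thesis by (auto simp: gsubmodule_iff calC_iff)
qed

lemma gsubmodule_calN: "gsubmodule calN"
proof -
  have "act l g \<in> calT" if g: "g \<in> GL" and l: "l \<in> calT" for l g
  proof -
    have "map_trace (alg_prod (act l g) x) = 0" for x
    proof -
      \<comment> \<open>\<open>?f\<close> is \<open>g\<close> followed by left multiplication by
        \<open>g x\<close>. Cyclicity of the trace moves \<open>inv g\<close> to the other side,
        where it cancels \<open>g\<close>.\<close>
      let ?f = "\<lambda>y. alg_prod l (g x) (g y)"
      have lin: "Vector_Spaces.linear scale scale ?f"
        using vector_space_axioms
        by (auto simp: Vector_Spaces.linear_iff alg_prod_add_right alg_prod_scale_right GL_D[OF g])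
      have "map_trace (alg_prod (act l g) x) = map_trace (inv g \<circ> ?f)"
        by (simp add: map_trace_eq alg_prod_act[OF g])
      also have "\<dots> = map_trace (?f \<circ> inv g)"
        by (intro map_trace_commute lin GL_D[OF g])
      also have "\<dots> = map_trace (alg_prod l (g x))"
        by (simp add: map_trace_eq GL_D[OF g])
      finally show ?thesis using l by (simp add: calT_def)
    qed
    then show ?thesis by (simp add: calT_def)
  qed
  then show ?thesis
    using gsubmodule_calC unfolding gsubmodule_iff calN_def
    by (auto simp: calT_iff trace_form_add trace_form_lscale) (auto simp: trace_form_def)
qed

lemma structure_vector_form:
  "structure_vector (\<lambda>x y. scale (\<theta> y) x + scale (\<theta> x) y) = form_tensor (\<lambda>i. \<theta> (v i))"
  by (auto simp: structure_vector_def form_tensor_def vec_eq_iff coord_add coord_scale coord_basis)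

text \<open>A linear form may take arbitrary values on the basis, so every
  \<open>form_tensor\<close> comes from some \<open>theta\<close>.\<close>

lemma calM11_eq: "calM11 = range form_tensor"
proof -
  have "\<exists>\<theta>\<in>dual. form_tensor t = structure_vector (\<lambda>x y. scale (\<theta> y) x + scale (\<theta> x) y)"
    for t :: "'n \<Rightarrow> 'f"
  proof
    let ?\<theta> = "\<lambda>x. \<Sum>i\<in>UNIV. coord x i * t i"
    show "?\<theta> \<in> dual"
      using vector_space_axioms vector_space_over_itself.vector_space_axioms
      by (auto simp: dual_def Vector_Spaces.linear_iff coord_add coord_scale algebra_simps
          sum.distrib sum_distrib_left)
    show "form_tensor t = structure_vector (\<lambda>x y. scale (?\<theta> y) x + scale (?\<theta> x) y)"
      unfolding structure_vector_form
      by (simp add: coord_basis mult_delta_left mult_delta_right)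
  qed
  then show ?thesis unfolding calM11_def using structure_vector_form by blast
qed

text \<open>Acting by \<open>g\<close> replaces \<open>theta\<close> by its composition with
  \<open>g\<close>, since \<open>inv g\<close> cancels \<open>g\<close> on the vector
  factors.\<close>

lemma gsubmodule_calM11: "gsubmodule calM11"
proof -
  have "act l g \<in> calM11" if g: "g \<in> GL" and "l \<in> calM11" for l g
  proof -
    obtain \<theta> where \<theta>: "\<theta> \<in> dual" "l = structure_vector (\<lambda>x y. scale (\<theta> y) x + scale (\<theta> x) y)"
      using \<open>l \<in> calM11\<close> by (auto simp: calM11_def)
    then have lin: "\<theta> (x + y) = \<theta> x + \<theta> y" "\<theta> (scale c x) = c * \<theta> x" for c x y
      by (auto simp: dual_def Vector_Spaces.linear_iff)
    have "alg_prod l x y = scale (\<theta> y) x + scale (\<theta> x) y" for x y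
      unfolding \<theta>(2) using vector_space_axioms
      by (intro alg_prod_structure_vector)
        (auto simp: Vector_Spaces.linear_iff lin algebra_simps)
    then have "act l g = structure_vector (\<lambda>x y. scale (\<theta> (g y)) x + scale (\<theta> (g x)) y)"
      by (simp add: act_def GL_D[OF g])
    moreover have "(\<lambda>x. \<theta> (g x)) \<in> dual"
      using \<theta>(1) by (auto simp: dual_def Vector_Spaces.linear_iff GL_D[OF g])
    ultimately show ?thesis by (auto simp: calM11_def)
  qed
  moreover have "0 = form_tensor (\<lambda>_. 0)" "form_tensor s + form_tensor t = form_tensor (\<lambda>i. s i + t i)"
    "lscale c (form_tensor s) = form_tensor (\<lambda>i. c * s i)" for c and s t :: "'n \<Rightarrow> 'f"
    by (auto simp: vec_eq_iff form_tensor_def algebra_simps)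
  ultimately show ?thesis by (auto simp: gsubmodule_iff calM11_eq)
qed

text \<open>The condition \<open>[x,x] \<in> span {x}\<close> is preserved by the action, so it
  holds for all transvected copies of \<open>l\<close>, and comparing components at basis vectors
  gives the hypotheses of \<open>form_tensorI\<close>.\<close>

lemma calC_inter_calMss:
  assumes "CHAR('f) \<noteq> 2"
  shows "calC \<inter> calMss \<subseteq> calM11"
proof
  fix l assume l: "l \<in> calC \<inter> calMss"
  have diag: "m $ i $ i $ k = 0" if "m \<in> calMss" "i \<noteq> k" for m i k
  proof -
    obtain c where "alg_prod m (v i) (v i) = scale c (v i)"
      using \<open>m \<in> calMss\<close> by (auto simp: calMss_def span_singleton)
    from arg_cong[OF this, of "\<lambda>x. coord x k"] show ?thesis
      using \<open>i \<noteq> k\<close> by (simp add: coord_alg_prod_basis coord_scale coord_basis)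
  qed
  have "transvect a b c l \<in> calMss" if ab: "a \<noteq> b" for a b c
  proof -
    obtain g where g: "g \<in> GL" "transvect a b c l = act l g"
      using act_transvection[OF ab, of c] by metis
    have "alg_prod (act l g) x x \<in> span {x}" for x
    proof -
      obtain d where "alg_prod l (g x) (g x) = scale d (g x)"
        using l by (auto simp: calMss_def span_singleton)
      then show ?thesis by (simp add: alg_prod_act[OF g(1)] GL_D(5,7)[OF g(1)] span_base span_scale)
    qed
    then show ?thesis using g by (simp add: calMss_def)
  qed
  then have "l = form_tensor (\<lambda>i. l $ i $ i $ i / 2)"
    using l diag by (intro form_tensorI two_nonzero assms) (auto simp: calC_iff)
  then show "l \<in> calM11" unfolding calM11_eq by blast
qed

lemma calM11_subset_calC: "calM11 \<subseteq> calC"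
  by (auto simp: calM11_eq calC_iff form_tensor_def)

text \<open>By \<open>trace_form_form_tensor\<close> the trace form is \<open>n + 1\<close> times
  the defining form, which is zero in this characteristic.\<close>

lemma calM11_subset_calN:
  assumes "CHAR('f) dvd CARD('n) + 1"
  shows "calM11 \<subseteq> calN"
proof -
  have "of_nat (CARD('n) + 1) = (0::'f)"
    using assms by (simp only: of_nat_eq_0_iff_char_dvd)
  then show ?thesis
    using calM11_subset_calC
    by (auto simp: calN_def calT_iff calM11_eq trace_form_form_tensor simp del: of_nat_add)
qed

lemma calN_inter_calM11:
  assumes "\<not> CHAR('f) dvd CARD('n) + 1"
  shows "calN \<inter> calM11 \<subseteq> {0}"
proof
  fix l assume l: "l \<in> calN \<inter> calM11"
  then obtain t :: "'n \<Rightarrow> 'f" where t: "l = form_tensor t" by (auto simp: calM11_eq)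
  have "of_nat (CARD('n) + 1) \<noteq> (0::'f)"
    using assms by (simp only: of_nat_eq_0_iff_char_dvd not_False_eq_True)
  moreover have "of_nat (CARD('n) + 1) * t i = 0" for i
    using l trace_form_form_tensor[of t i] t by (simp add: calN_def calT_iff)
  ultimately have "t i = 0" for i by (metis mult_eq_0_iff)
  then show "l \<in> {0}" by (simp add: t form_tensor_def vec_eq_iff)
qed

lemma direct_sum_calC:
  assumes "\<not> CHAR('f) dvd CARD('n) + 1"
  shows "direct_sum calC calN calM11"
proof -
  have n: "of_nat (CARD('n) + 1) \<noteq> (0::'f)"
    using assms by (simp only: of_nat_eq_0_iff_char_dvd not_False_eq_True)
  have "\<exists>a b. l = a + b \<and> a \<in> calN \<and> b \<in> calM11" if "l \<in> calC" for l
  proof (intro exI conjI)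
    \<comment> \<open>Dividing by \<open>n + 1\<close> compensates the factor in
      \<open>trace_form_form_tensor\<close>, so \<open>?b\<close> has the same trace form as
      \<open>l\<close>.\<close>
    let ?b = "form_tensor (\<lambda>i. trace_form l i / of_nat (CARD('n) + 1))"
    show "l = (l - ?b) + ?b" by simp
    show "?b \<in> calM11" by (simp add: calM11_eq)
    have "l - ?b \<in> calC"
      using that by (auto simp: calC_iff form_tensor_def)
    then show "l - ?b \<in> calN"
      using n by (simp add: calN_def calT_iff trace_form_diff trace_form_form_tensor del: of_nat_add)
  qed
  moreover have "a + b \<in> calC" if "a \<in> calN" "b \<in> calM11" for a b
    using that calM11_subset_calC by (auto simp: calN_def calC_iff)
  moreover have "0 \<in> calN \<inter> calM11"
    using gsubmodule_calN gsubmodule_calM11 by (simp add: gsubmodule_iff)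
  ultimately show ?thesis
    using calN_inter_calM11[OF assms] unfolding direct_sum_def by blast
qed

text \<open>The witness \<open>x_a^2 v_b\<close> has zero traces, but its entry at
  \<open>(a, a, b)\<close> is 1, where every form tensor vanishes.\<close>

lemma calN_not_subset_calM11:
  assumes "CARD('n) \<ge> 2"
  shows "\<not> calN \<subseteq> calM11"
proof -
  obtain a b :: 'n where ab: "a \<noteq> b"
    using ex_notin_of_card_less[of "{undefined :: 'n}"] assms by auto
  let ?s = "square_tensor (unit_form a) (unit_form b) :: 'f^'n^'n^'n"
  have "?s $ i $ j $ j = 0" for i j using ab by (simp add: square_tensor_def unit_form_def)
  then have "?s \<in> calN"
    by (simp add: calN_def calC_iff calT_iff trace_form_def) (simp add: square_tensor_def)
  moreover have "?s \<noteq> form_tensor t" for t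
  proof
    assume "?s = form_tensor t"
    then have "?s $ a $ a $ b = form_tensor t $ a $ a $ b" by simp
    then show False using ab by (simp add: square_tensor_def unit_form_def form_tensor_def)
  qed
  ultimately show ?thesis by (auto simp: calM11_eq)
qed

text \<open>The symmetric product \<open>x_a^2 v_a\<close> has a nonzero trace at
  \<open>v_a\<close>.\<close>

lemma calN_neq_calC: "calN \<noteq> calC"
proof -
  obtain a :: 'n where True by simp
  let ?s = "square_tensor (unit_form a) (unit_form a) :: 'f^'n^'n^'n"
  have "trace_form ?s a \<noteq> 0"
    by (simp add: trace_form_def square_tensor_def unit_form_def mult_delta_left mult_delta_right)
  then have "?s \<notin> calN" using calT_iff[of ?s] unfolding calN_def by blast
  moreover have "?s \<in> calC" by (simp add: calC_iff square_tensor_def)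
  ultimately show ?thesis by blast
qed

lemma calM11_neq_0:
  assumes "CHAR('f) \<noteq> 2"
  shows "calM11 \<noteq> {0}"
proof -
  have "form_tensor (\<lambda>_. 1) \<noteq> (0 :: 'f^'n^'n^'n)"
    using form_tensor_eq_0_iff[OF two_nonzero[OF assms]] by (metis zero_neq_one)
  then show ?thesis unfolding calM11_eq by blast
qed

section \<open>Classification of the submodules and composition series\<close>

text \<open>Inside \<open>calM11\<close> any nonzero element generates everything. Otherwise
  \<open>W\<close> contains some \<open>x_r^2 v_p\<close>, hence all of \<open>calN\<close>, and one
  element with nonzero trace form enlarges it to \<open>calC\<close>.\<close>

lemma gsubmodules_of_calC:
  assumes char: "CHAR('f) \<noteq> 2" and card: "CARD('n) \<ge> 3" and W: "gsubmodule W" "W \<subseteq> calC"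
  shows "W \<in> {{0}, calM11, calN, calC}"
proof -
  interpret transvection_module W using W(1) char by (rule gsubmodule_transvection_module)
  have sym: "l $ i $ j $ k = l $ j $ i $ k" if "l \<in> W" for l i j k
    using W that by (auto simp: calC_iff)
  show ?thesis
  proof (cases "W \<subseteq> calM11")
    case True
    show ?thesis
    proof (cases "W = {0}")
      case False
      then obtain l where l: "l \<in> W" "l \<noteq> 0" using zero by blast
      then obtain t where t: "l = form_tensor t" using True by (auto simp: calM11_eq)
      then have "t \<noteq> (\<lambda>_. 0)" using l form_tensor_eq_0_iff[OF two, of t] by simp
      then obtain b where "t b \<noteq> 0" by (auto simp: fun_eq_iff)
      then have "form_tensor s \<in> W" for s
        using form_tensors_generated[of t b s] l t card by simp
      then have "calM11 \<subseteq> W" unfolding calM11_eq by blast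
      with True have "W = calM11" by (rule subset_antisym)
      then show ?thesis by simp
    qed simp
  next
    case False
    then obtain l where l: "l \<in> W" "l \<notin> range form_tensor" unfolding calM11_eq by blast
    obtain r p where "r \<noteq> p" "square_tensor (unit_form r) (unit_form p) \<in> W"
      using square_tensor_from_nonform[OF l(1) sym card l(2)] by blast
    then have sq: "square_tensor (unit_form a) (unit_form b) \<in> W" if "a \<noteq> b" for a b
      using square_tensor_all[OF card] that by metis
    have N: "m \<in> W" if "\<And>i j k. m $ i $ j $ k = m $ j $ i $ k" "\<And>i. trace_form m i = 0" for m
      using sq that by (rule trace_zero_generated)
    have NW: "calN \<subseteq> W"
      by (rule subsetI, rule N) (simp_all add: calN_def calC_iff calT_iff)
    show ?thesis
    proof (cases "W \<subseteq> calN")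
      case False
      then obtain l where "l \<in> W" "l \<notin> calT" using W by (auto simp: calN_def)
      moreover from this obtain b where "trace_form l b \<noteq> 0"
        unfolding calT_iff by blast
      ultimately have l: "l \<in> W" "trace_form l b \<noteq> 0" by simp_all
      have "s \<in> W" if "s \<in> calC" for s
      proof (rule trace_zero_maximal[OF _ l])
        show "2 \<le> CARD('n)" using card by simp
        show "s $ i $ j $ k = s $ j $ i $ k" for i j k using that by (simp add: calC_iff)
      qed (fact sym, fact N)
      then have "W = calC" using W(2) by blast
      then show ?thesis by simp
    next
      case True
      with NW have "W = calN" by (simp add: subset_antisym)
      then show ?thesis by simp
    qed
  qed
qed

text \<open>Every submodule between \<open>A\<close> and \<open>B\<close> is inside
  \<open>calC\<close> and so belongs to \<open>L\<close>; maximality among all submodules is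
  therefore covering in the finite order \<open>L\<close>.\<close>

lemma maximal_gsubmodule_in_calC:
  assumes "CHAR('f) \<noteq> 2" "CARD('n) \<ge> 3"
  defines "L \<equiv> {{0}, calM11, calN, calC}"
  shows "maximal_gsubmodule A B \<and> B \<subseteq> calC \<longleftrightarrow> covers_in L A B"
proof -
  have "lscale c 0 = (0 :: 'f^'n^'n^'n)" for c by (simp add: vec_eq_iff)
  then have "gsubmodule {0}"
    unfolding gsubmodule_iff by (simp add: act_zero)
  moreover have "{0} \<subseteq> calC" using gsubmodule_calC by (simp add: gsubmodule_iff)
  moreover have "calN \<subseteq> calC" by (simp add: calN_def)
  ultimately have L: "X \<in> L \<Longrightarrow> gsubmodule X \<and> X \<subseteq> calC" for X
    using gsubmodule_calC gsubmodule_calN gsubmodule_calM11 calM11_subset_calC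
    unfolding L_def by (elim insertE emptyE) simp_all
  have sub: "X \<in> L" if "gsubmodule X" "X \<subseteq> calC" for X
    using gsubmodules_of_calC[OF assms(1,2) that] unfolding L_def .
  show ?thesis
    unfolding covers_in_def
  proof
    assume "maximal_gsubmodule A B \<and> B \<subseteq> calC"
    then have AB: "gsubmodule A" "gsubmodule B" "A \<subset> B" "B \<subseteq> calC"
      and max: "\<And>X. gsubmodule X \<Longrightarrow> A \<subseteq> X \<Longrightarrow> X \<subseteq> B \<Longrightarrow> X = A \<or> X = B"
      unfolding maximal_gsubmodule_def by simp_all
    have "A \<subseteq> calC" using AB by simp
    then have "A \<in> L" "B \<in> L" using AB sub by simp_all
    moreover have "\<forall>X\<in>L. A \<subseteq> X \<and> X \<subseteq> B \<longrightarrow> X = A \<or> X = B" using max L by simp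
    ultimately show "A \<in> L \<and> B \<in> L \<and> A \<subset> B \<and> (\<forall>X\<in>L. A \<subseteq> X \<and> X \<subseteq> B \<longrightarrow> X = A \<or> X = B)"
      using AB by simp
  next
    assume AB: "A \<in> L \<and> B \<in> L \<and> A \<subset> B \<and> (\<forall>X\<in>L. A \<subseteq> X \<and> X \<subseteq> B \<longrightarrow> X = A \<or> X = B)"
    have "X = A \<or> X = B" if "gsubmodule X" "A \<subseteq> X" "X \<subseteq> B" for X
    proof -
      have "B \<subseteq> calC" using L[of B] AB by simp
      with that(3) have "X \<subseteq> calC" by (rule subset_trans)
      then show ?thesis using sub[OF that(1)] that AB by simp
    qed
    then show "maximal_gsubmodule A B \<and> B \<subseteq> calC"
      unfolding maximal_gsubmodule_def using L[of A] L[of B] AB by simp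
  qed
qed

text \<open>The relations valid whether or not the characteristic divides \<open>n + 1\<close>; only
  the inclusion of \<open>calM11\<close> in \<open>calN\<close> depends on that.\<close>

lemma submodule_lattice:
  assumes char: "CHAR('f) \<noteq> 2" and card: "CARD('n) \<ge> 3"
  shows "{0} \<subset> calM11" "{0} \<subset> calN" "calM11 \<subset> calC" "calN \<subset> calC" "\<not> calN \<subseteq> calM11"
proof -
  show *: "\<not> calN \<subseteq> calM11" using calN_not_subset_calM11 card by simp
  have zero: "0 \<in> calM11" "0 \<in> calN"
    using gsubmodule_calM11 gsubmodule_calN by (simp_all add: gsubmodule_iff)
  have "calN \<subseteq> calC" by (simp add: calN_def)
  then show "calM11 \<subset> calC" "calN \<subset> calC"
    using * calM11_subset_calC calN_neq_calC by (auto simp only: psubset_eq)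
  have "{0} \<subseteq> calM11" using zero by (simp only: insert_subset empty_subsetI simp_thms)
  with * have "calN \<noteq> {0}" by metis
  then show "{0} \<subset> calM11" "{0} \<subset> calN"
    using zero calM11_neq_0[OF char] by (simp_all add: psubset_eq not_sym)
qed

lemma not_calM11_subset_calN:
  assumes "CHAR('f) \<noteq> 2" "CARD('n) \<ge> 3" "\<not> CHAR('f) dvd CARD('n) + 1"
  shows "\<not> calM11 \<subseteq> calN"
proof
  assume "calM11 \<subseteq> calN"
  then have "calM11 \<subseteq> {0}" using calN_inter_calM11[OF assms(3)] by (simp add: Int_absorb1)
  then show False using submodule_lattice(1)[OF assms(1,2)] by (simp only: less_le_not_le simp_thms)
qed

text \<open>Unrolling \<open>chain_lists_step\<close> from \<open>{0}\<close> with the known covers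
  ends at \<open>calC\<close> after at most three steps.\<close>

lemma composition_series_calC:
  assumes char: "CHAR('f) \<noteq> 2" and card: "CARD('n) \<ge> 3"
  shows "CHAR('f) dvd CARD('n) + 1 \<Longrightarrow> {Ws. composition_series Ws calC} = {[{0}, calM11, calN, calC]}"
    and "\<not> CHAR('f) dvd CARD('n) + 1 \<Longrightarrow>
      {Ws. composition_series Ws calC} = {[{0}, calN, calC], [{0}, calM11, calC]}"
proof -
  note lat = submodule_lattice[OF char card]
  have less: "A < B" if "maximal_gsubmodule A B" for A B
    using that by (simp add: maximal_gsubmodule_def)
  have series: "{Ws. composition_series Ws calC} = chain_lists maximal_gsubmodule {0} calC"
    by (simp add: composition_series_def chain_lists_def successively_conv_nth)
  have step: "chain_lists maximal_gsubmodule A calC =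
      (\<Union>B\<in>{B. covers_in {{0}, calM11, calN, calC} A B}. (#) A ` chain_lists maximal_gsubmodule B calC)"
    if "A \<noteq> calC" for A
    using chain_lists_step[of maximal_gsubmodule, OF less that]
    unfolding maximal_gsubmodule_in_calC[OF char card] by simp
  note last = chain_lists_self[of maximal_gsubmodule, OF less]
  have "{0} < calC" using lat by order
  then have neq: "{0} \<noteq> calC" "calM11 \<noteq> calC" "calN \<noteq> calC" using lat by order+
  note steps = step[OF neq(1)] step[OF neq(2)] step[OF neq(3)]
  {
    assume "CHAR('f) dvd CARD('n) + 1"
    then have "calM11 \<subseteq> calN" by (rule calM11_subset_calN)
    then have "calM11 < calN" using lat(5) by order
    note covers = covers_in_chain[OF lat(1) this lat(4)]
    show "{Ws. composition_series Ws calC} = {[{0}, calM11, calN, calC]}"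
      unfolding series by (simp add: steps covers last)
  }
  {
    assume "\<not> CHAR('f) dvd CARD('n) + 1"
    then have "\<not> calM11 \<subseteq> calN" by (rule not_calM11_subset_calN[OF char card])
    note covers = covers_in_square[OF lat(1-4) this lat(5)]
    show "{Ws. composition_series Ws calC} = {[{0}, calN, calC], [{0}, calM11, calC]}"
      unfolding series by (simp add: steps covers last)
  }
qed

text \<open>By the classification, a further submodule of either one could only be the other or
  \<open>calC\<close>, and neither of these is contained in it.\<close>

lemma irreducible_calN_calM11:
  assumes "CHAR('f) \<noteq> 2" "CARD('n) \<ge> 3" "\<not> CHAR('f) dvd CARD('n) + 1"
  shows "irreducible_gmodule calN" "irreducible_gmodule calM11"
proof -
  note lat = submodule_lattice[OF assms(1,2)]
  have cases: "U = {0} \<or> U = calM11 \<or> U = calN \<or> U = calC" if "gsubmodule U" "U \<subseteq> calC" for U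
    using gsubmodules_of_calC[OF assms(1,2) that] by simp
  have "U = {0} \<or> U = calN" if "gsubmodule U" "U \<subseteq> calN" for U
  proof -
    have "U \<subseteq> calC" using that lat by order
    then show ?thesis
      using cases[OF that(1)] that(2) lat not_calM11_subset_calN[OF assms] by (metis leD)
  qed
  then show "irreducible_gmodule calN"
    using gsubmodule_calN lat(2) by (simp add: irreducible_gmodule_def psubset_eq not_sym)
  have "U = {0} \<or> U = calM11" if "gsubmodule U" "U \<subseteq> calM11" for U
  proof -
    have "U \<subseteq> calC" using that lat by order
    then show ?thesis
      using cases[OF that(1)] that(2) lat by (metis leD)
  qed
  then show "irreducible_gmodule calM11"
    using gsubmodule_calM11 lat(1) by (simp add: irreducible_gmodule_def psubset_eq not_sym)
qed

end

theorem mainTheorem2: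
  fixes scale :: "'f::field \<Rightarrow> 'v::ab_group_add \<Rightarrow> 'v"
    and v :: "'n::finite \<Rightarrow> 'v"
  assumes "based_vector_space scale v"
    and "infinite (UNIV :: 'f set) \<or> CARD('f) > 2"
    and "CHAR('f) \<noteq> 2"
    and "CARD('n) \<ge> 3"
  defines "C \<equiv> based_vector_space.calC scale v"
    and "N \<equiv> based_vector_space.calN scale v"
    and "M11 \<equiv> based_vector_space.calM11 scale v"
    and "Mss \<equiv> based_vector_space.calMss scale v"
  shows "{W. based_vector_space.gsubmodule scale v W \<and> W \<subseteq> C \<and> W \<noteq> {0} \<and> W \<noteq> C} = {N, M11}
    \<and> (\<not> CHAR('f) dvd CARD('n) + 1 \<longrightarrow>
         N \<inter> Mss = {0}
         \<and> direct_sum C N M11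
         \<and> based_vector_space.irreducible_gmodule scale v N
         \<and> based_vector_space.irreducible_gmodule scale v M11
         \<and> card {Ws. based_vector_space.composition_series scale v Ws C} = 2)
    \<and> (CHAR('f) dvd CARD('n) + 1 \<longrightarrow>
         {Ws. based_vector_space.composition_series scale v Ws C} = {[{0}, M11, N, C]})"
proof -
  interpret based_vector_space scale v by fact
  note lat = submodule_lattice[OF assms(3,4)]
  have "{W. gsubmodule W \<and> W \<subseteq> calC \<and> W \<noteq> {0} \<and> W \<noteq> calC} = {calN, calM11}"
  proof (intro subset_antisym subsetI)
    fix W assume "W \<in> {W. gsubmodule W \<and> W \<subseteq> calC \<and> W \<noteq> {0} \<and> W \<noteq> calC}"
    then show "W \<in> {calN, calM11}"
      using gsubmodules_of_calC[OF assms(3,4), of W]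
      by (simp only: mem_Collect_eq insert_iff empty_iff) metis
  next
    fix W assume "W \<in> {calN, calM11}"
    moreover have "calM11 \<noteq> {0}" "calN \<noteq> {0}" "calM11 \<noteq> calC" "calN \<noteq> calC"
        "calM11 \<subseteq> calC" "calN \<subseteq> calC"
      using lat by order+
    ultimately show "W \<in> {W. gsubmodule W \<and> W \<subseteq> calC \<and> W \<noteq> {0} \<and> W \<noteq> calC}"
      using gsubmodule_calN gsubmodule_calM11 by (elim insertE emptyE) simp_all
  qed
  moreover have "calN \<inter> calMss = {0}" if "\<not> CHAR('f) dvd CARD('n) + 1"
  proof (rule subset_antisym)
    \<comment> \<open>Symmetry of the elements of \<open>calN\<close> lets
      \<open>calC_inter_calMss\<close> place the intersection in \<open>calM11\<close>, which meets
      \<open>calN\<close> only in zero.\<close>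
    have "calN \<inter> calMss \<subseteq> calN \<inter> calM11"
      using calC_inter_calMss[OF assms(3)] by (auto simp: calN_def)
    then show "calN \<inter> calMss \<subseteq> {0}" using calN_inter_calM11[OF that] by (rule subset_trans)
    have "0 \<in> calMss"
      by (simp add: calMss_def alg_prod_def span_zero)
    then show "{0} \<subseteq> calN \<inter> calMss" using lat(2) by (simp add: psubset_eq)
  qed
  moreover have "card {Ws. composition_series Ws calC} = 2" if "\<not> CHAR('f) dvd CARD('n) + 1"
  proof -
    \<comment> \<open>Different middle terms make the two series different lists, so the set has two
      elements.\<close>
    have "calM11 \<noteq> calN" using lat by auto
    then show ?thesis
      unfolding composition_series_calC(2)[OF assms(3,4) that] by simp
  qed
  ultimately show ?thesis
    unfolding C_def N_def M11_def Mss_def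
    using direct_sum_calC irreducible_calN_calM11[OF assms(3,4)] composition_series_calC(1)[OF assms(3,4)]
    by simp
qed

end
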